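(* Let $n, M, K \ge 1$ be integers and $\mathcal{X} = [0,1]^n$. Let $\mathcal{B} = \{B_1, \dots, B_M\}$ be a set of (nonempty) axis-aligned boxes in $\mathbb{R}^n$ with associated labels $y_1, \dots, y_M \in \{1, \dots, K\}$. For $x \in \mathcal{X}$ define $$m^\star = \operatorname*{arg\,min}_{m} \mathrm{dist}(x, B_m), \qquad d_1 = \mathrm{dist}(x, B_{m^\star}), \qquad d_2 = \min_{m \colon y_m \neq y_{m^\star}} \mathrm{dist}(x, B_m),$$ and $\mathrm{margin}(x) = d_2 - d_1$. Then for every $x' \in \mathcal{X}$ with $\|x' - x\|_0 < \mathrm{margin}(x)/2$, $$\textsc{Box-NN}(x, \mathcal{B}) = \textsc{Box-NN}(x', \mathcal{B}).$$
   Context: $\|v\|_0$ denotes the number of nonzero coordinates of $v \in \mathbb{R}^n$. An axis-aligned box is a set $B(a,b) = \{x \in \mathbb{R}^n : a \le x \le b\}$ with $a, b \in \mathbb{R}^n$, inequalities being element-wise. For $x \in \mathbb{R}^n$ and $S \subseteq \mathbb{R}^n$, $\mathrm{dist}(x, S) = \min\{\|v\|_0 : v \in \mathbb{R}^n,\ x + v \in S\}$, the minimum number of coordinate changes needed to get from $x$ to $S$. The Box-NN classifier is defined by $\textsc{Box-NN}(x, \mathcal{B}) = y_{m^\star}$, where $m^\star = \operatorname*{arg\,min}_m \mathrm{dist}(x, B_m)$ (a minimizing index, ties broken by any fixed rule). A minimum over an empty set of indices is $+\infty$. *)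

theory Defs
  imports "HOL-Analysis.Analysis"
begin

definition l0_norm :: "real ^ 'n \<Rightarrow> nat" where
  "l0_norm v = card {i. v $ i \<noteq> 0}"

definition unit_cube :: "(real ^ 'n) set" where
  "unit_cube = {x. \<forall>i. 0 \<le> x $ i \<and> x $ i \<le> 1}"

text \<open>The order on \<^typ>\<open>real ^ 'n\<close> is componentwise.\<close>

definition axis_box :: "(real ^ 'n) set \<Rightarrow> bool" where
  "axis_box S \<longleftrightarrow> (\<exists>a b. S = {a..b})"

text \<open>In \<^typ>\<open>enat\<close> the infimum of a nonempty set is its minimum, and the infimum of the
  empty set is \<^term>\<open>\<infinity> :: enat\<close>.\<close>

definition l0_dist :: "real ^ 'n \<Rightarrow> (real ^ 'n) set \<Rightarrow> enat" where
  "l0_dist x S = (INF v\<in>{v. x + v \<in> S}. enat (l0_norm v))"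

lemma l0_dist_attained:
  assumes "S \<noteq> {}"
  shows "\<exists>v. x + v \<in> S \<and> l0_dist x S = enat (l0_norm v)"
proof -
  obtain s where "s \<in> S" using assms by blast
  then have "x + (s - x) \<in> S" by simp
  then have "enat (l0_norm (s - x)) \<in> (\<lambda>v. enat (l0_norm v)) ` {v. x + v \<in> S}" by blast
  then have "l0_dist x S \<in> (\<lambda>v. enat (l0_norm v)) ` {v. x + v \<in> S}"
    unfolding l0_dist_def by (rule wellorder_InfI)
  then show ?thesis by auto
qed

text \<open>The boxes are a family \<open>B\<close> indexed by \<open>{1..M}\<close>. A tie-breaking rule picks an element
  from each nonempty set of indices; the choice may depend on the query point.\<close>

definition nearest_boxes :: "nat \<Rightarrow> (nat \<Rightarrow> (real ^ 'n) set) \<Rightarrow> real ^ 'n \<Rightarrow> nat set" where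
  "nearest_boxes M B x = {m. is_arg_min (\<lambda>m. l0_dist x (B m)) (\<lambda>m. m \<in> {1..M}) m}"

definition tie_rule :: "(real ^ 'n \<Rightarrow> nat set \<Rightarrow> nat) \<Rightarrow> bool" where
  "tie_rule \<tau> \<longleftrightarrow> (\<forall>x I. I \<noteq> {} \<longrightarrow> \<tau> x I \<in> I)"

definition m_star ::
    "(real ^ 'n \<Rightarrow> nat set \<Rightarrow> nat) \<Rightarrow> nat \<Rightarrow> (nat \<Rightarrow> (real ^ 'n) set) \<Rightarrow> real ^ 'n \<Rightarrow> nat" where
  "m_star \<tau> M B x = \<tau> x (nearest_boxes M B x)"

definition box_nn ::
    "(real ^ 'n \<Rightarrow> nat set \<Rightarrow> nat) \<Rightarrow> nat \<Rightarrow> (nat \<Rightarrow> (real ^ 'n) set) \<Rightarrow> (nat \<Rightarrow> nat)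
      \<Rightarrow> real ^ 'n \<Rightarrow> nat" where
  "box_nn \<tau> M B y x = y (m_star \<tau> M B x)"

definition d1 ::
    "(real ^ 'n \<Rightarrow> nat set \<Rightarrow> nat) \<Rightarrow> nat \<Rightarrow> (nat \<Rightarrow> (real ^ 'n) set) \<Rightarrow> real ^ 'n \<Rightarrow> enat" where
  "d1 \<tau> M B x = l0_dist x (B (m_star \<tau> M B x))"

definition d2 ::
    "(real ^ 'n \<Rightarrow> nat set \<Rightarrow> nat) \<Rightarrow> nat \<Rightarrow> (nat \<Rightarrow> (real ^ 'n) set) \<Rightarrow> (nat \<Rightarrow> nat)
      \<Rightarrow> real ^ 'n \<Rightarrow> enat" where
  "d2 \<tau> M B y x = (INF m\<in>{m \<in> {1..M}. y m \<noteq> y (m_star \<tau> M B x)}. l0_dist x (B m))"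

text \<open>Taken in \<^typ>\<open>ereal\<close>, since \<^const>\<open>d2\<close> is infinite when all labels agree, and so that
  subtraction is not truncated and halving is exact.\<close>

definition margin ::
    "(real ^ 'n \<Rightarrow> nat set \<Rightarrow> nat) \<Rightarrow> nat \<Rightarrow> (nat \<Rightarrow> (real ^ 'n) set) \<Rightarrow> (nat \<Rightarrow> nat)
      \<Rightarrow> real ^ 'n \<Rightarrow> ereal" where
  "margin \<tau> M B y x = ereal_of_enat (d2 \<tau> M B y x) - ereal_of_enat (d1 \<tau> M B x)"

end

theory Submission
  imports Defs
begin

text \<open>The map \<open>l0_dist \<cdot> S\<close> is 1-Lipschitz for the Hamming distance. If moving \<open>x\<close> to \<open>x'\<close> changes
  \<open>\<delta>\<close> coordinates and a box \<open>B\<^sub>k\<close> with another label than the box \<open>B\<^sub>m\<close> chosen at \<open>x\<close>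
  is nearest to \<open>x'\<close>, then \<open>d\<^sub>2 \<le> dist(x, B\<^sub>k) \<le> dist(x', B\<^sub>k) + \<delta> \<le> dist(x', B\<^sub>m) + \<delta> \<le> d\<^sub>1 + 2\<delta>\<close>.\<close>

lemma l0_norm_triangle: "l0_norm (u + v) \<le> l0_norm u + l0_norm (v :: real ^ 'n)"
proof -
  have "l0_norm (u + v) \<le> card ({i. u $ i \<noteq> 0} \<union> {i. v $ i \<noteq> 0})"
    unfolding l0_norm_def by (rule card_mono) auto
  also have "\<dots> \<le> l0_norm u + l0_norm v"
    unfolding l0_norm_def by (rule card_Un_le)
  finally show ?thesis .
qed

lemma l0_norm_minus_commute: "l0_norm (u - v) = l0_norm (v - u :: real ^ 'n)"
  unfolding l0_norm_def by (rule arg_cong[where f = card]) auto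

text \<open>Step from \<open>x\<close> to \<open>x'\<close>, then along an optimal \<open>v\<close>
  from \<open>x'\<close> into \<open>S\<close>: the combined move reaches \<open>S\<close>, and its
  cost is bounded by the triangle inequality. For empty \<open>S\<close> both sides are
  infinite.\<close>

lemma l0_dist_lipschitz: "l0_dist x S \<le> l0_dist x' S + enat (l0_norm (x' - x))"
proof (cases "S = {}")
  case True
  then show ?thesis by (simp add: l0_dist_def top_enat_def)
next
  case False
  then obtain v where v: "x' + v \<in> S" and dist: "l0_dist x' S = enat (l0_norm v)"
    using l0_dist_attained by blast
  from v have "l0_dist x S \<le> enat (l0_norm (v + (x' - x)))"
    unfolding l0_dist_def by (intro INF_lower) (simp add: add.commute)
  also have "\<dots> \<le> enat (l0_norm v) + enat (l0_norm (x' - x))"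
    by (simp add: l0_norm_triangle)
  finally show ?thesis using dist by simp
qed

lemma m_star_nearest:
  assumes "M \<ge> 1" and "tie_rule \<tau>"
  shows "m_star \<tau> M B x \<in> {1..M}"
    and "k \<in> {1..M} \<Longrightarrow> l0_dist x (B (m_star \<tau> M B x)) \<le> l0_dist x (B k)"
proof -
  \<comment> \<open>A minimizer exists because \<open>{1..M}\<close> is finite and nonempty;
    \<open>tie_rule\<close> constrains the choice only on nonempty sets.\<close>
  have "\<exists>m. is_arg_min (\<lambda>m. l0_dist x (B m)) (\<lambda>m. m \<in> {1..M}) m"
    using assms(1) by (intro ex_is_arg_min_if_finite[where S = "{1..M}"]) auto
  then have "nearest_boxes M B x \<noteq> {}"
    by (simp add: nearest_boxes_def)
  then have "m_star \<tau> M B x \<in> nearest_boxes M B x"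
    using assms(2) by (simp add: m_star_def tie_rule_def)
  then show "m_star \<tau> M B x \<in> {1..M}"
    and "k \<in> {1..M} \<Longrightarrow> l0_dist x (B (m_star \<tau> M B x)) \<le> l0_dist x (B k)"
    by (auto simp: nearest_boxes_def is_arg_min_linorder)
qed

theorem theorem4p2:
  fixes M K :: nat
    and B :: "nat \<Rightarrow> (real ^ 'n) set"
    and y :: "nat \<Rightarrow> nat"
    and \<tau> :: "real ^ 'n \<Rightarrow> nat set \<Rightarrow> nat"
    and x x' :: "real ^ 'n"
  assumes "M \<ge> 1" and "K \<ge> 1"
    and "\<And>m. m \<in> {1..M} \<Longrightarrow> axis_box (B m) \<and> B m \<noteq> {}"
    and "\<And>m. m \<in> {1..M} \<Longrightarrow> y m \<in> {1..K}"
    and "tie_rule \<tau>"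
    and "x \<in> unit_cube" and "x' \<in> unit_cube"
    and "ereal (real (l0_norm (x' - x))) < margin \<tau> M B y x / 2"
  shows "box_nn \<tau> M B y x = box_nn \<tau> M B y x'"
proof (rule ccontr)
  define \<delta> where "\<delta> = l0_norm (x' - x)"
  define m where "m = m_star \<tau> M B x"
  define k where "k = m_star \<tau> M B x'"
  assume "box_nn \<tau> M B y x \<noteq> box_nn \<tau> M B y x'"
  then have "y k \<noteq> y m" by (simp add: box_nn_def m_def k_def)
  have mk: "m \<in> {1..M}" "k \<in> {1..M}"
    unfolding m_def k_def by (intro m_star_nearest assms)+
  \<comment> \<open>Nonemptiness of \<open>B m\<close> makes \<open>d1\<close> finite, so that the
    margin is not a difference of two infinities.\<close>
  obtain a where a: "l0_dist x (B m) = enat a"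
    using l0_dist_attained[of "B m" x] assms(3)[OF mk(1)] by blast
  have "d2 \<tau> M B y x \<le> l0_dist x (B k)"
    unfolding d2_def using \<open>y k \<noteq> y m\<close> mk(2) by (intro INF_lower) (simp add: m_def)
  also have "\<dots> \<le> l0_dist x' (B k) + enat \<delta>"
    unfolding \<delta>_def by (rule l0_dist_lipschitz)
  also have "\<dots> \<le> l0_dist x' (B m) + enat \<delta>"
    unfolding k_def by (intro add_right_mono m_star_nearest assms mk)
  \<comment> \<open>The Lipschitz bound is now used from \<open>x'\<close> to \<open>x\<close>,
    hence the symmetry of the norm.\<close>
  also have "\<dots> \<le> l0_dist x (B m) + enat \<delta> + enat \<delta>"
    unfolding \<delta>_def l0_norm_minus_commute[of x' x]
    by (intro add_right_mono l0_dist_lipschitz)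
  finally have "d2 \<tau> M B y x \<le> enat (a + \<delta> + \<delta>)" using a by simp
  \<comment> \<open>The bound also forces \<open>d2\<close> to be finite, so half the margin is the
    real number \<open>(b - a) / 2\<close>, at most \<delta>.\<close>
  then obtain b where "d2 \<tau> M B y x = enat b" and "b \<le> a + \<delta> + \<delta>"
    by (cases "d2 \<tau> M B y x") auto
  then have "margin \<tau> M B y x / 2 \<le> ereal (real \<delta>)"
    using a by (simp add: margin_def d1_def m_def)
  then show False using assms(8) by (simp add: \<delta>_def)
qed

end
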